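(* Let $c \ge 4$ be an integer, $r = 1/c$ and $f(x) = x^2 + r$. If the iterate $f^m(x)$ is irreducible over $\mathbb{Q}$ for \[ m = 1 + \Bigl\lfloor \log_2\Bigl(1 + \frac{\log 4 + \varepsilon(c)/\sqrt{c}}{\log(1 + 1/\sqrt{c})}\Bigr) \Bigr\rfloor , \] then $f^n(x)$ is irreducible over $\mathbb{Q}$ for all $n \ge 1$.
   Context: $\log$ is the natural logarithm. For $c \ge 4$, $F(c) = \frac{1}{2}\bigl(1 - \sqrt{1 - 4/c}\bigr)$ and $\varepsilon(c) = \sqrt{c}\,\log \dfrac{1 + \sqrt{F(c)}}{1 - \sqrt{F(c)}}$. $f^n$ denotes the $n$-th iterate of $f$. *)

theory Defs
  imports Complex_Main "HOL-Computational_Algebra.Computational_Algebra"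
begin

definition F :: "real \<Rightarrow> real" where
  "F c = (1 - sqrt (1 - 4 / c)) / 2"

definition eps :: "real \<Rightarrow> real" where
  "eps c = sqrt c * ln ((1 + sqrt (F c)) / (1 - sqrt (F c)))"

definition quad_poly :: "'a::comm_semiring_1 \<Rightarrow> 'a poly" where
  "quad_poly r = [:r, 0, 1:]"

text \<open>Iteration of polynomials is iterated composition, starting from the polynomial $x$.\<close>

definition poly_iterate :: "'a::comm_semiring_1 poly \<Rightarrow> nat \<Rightarrow> 'a poly" where
  "poly_iterate p n = (pcompose p ^^ n) [:0, 1:]"

text \<open>For \<open>c \<ge> 4\<close> the argument of the base-2 logarithm exceeds \<open>1\<close>, so the conversion
  to \<^typ>\<open>nat\<close> truncates nothing.\<close>

definition test_index :: "real \<Rightarrow> nat" where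
  "test_index c = nat (1 + \<lfloor>log 2 (1 + (ln 4 + eps c / sqrt c) / ln (1 + 1 / sqrt c))\<rfloor>)"

end

theory Submission
  imports Defs
begin

text \<open>If \<open>f\<^sup>n\<close> is irreducible and \<open>f\<^sup>n\<^sup>+\<^sup>1\<close> is not, with \<open>n \<ge> 1\<close>, then \<open>f\<^sup>n\<^sup>+\<^sup>1(0)\<close> is a square in the
  rationals. Write \<open>f\<^sup>n(0) = a / c\<^bsup>2^(n-1)\<^esup>\<close> and \<open>N = 2\<^sup>n - 1\<close>; then \<open>a\<^sup>2 + c\<^sup>N = y\<^sup>2\<close>, so
  \<open>(y - a) (y + a) = c\<^sup>N\<close>. As \<open>a\<close> is coprime to \<open>c\<close>, both factors are \<open>N\<close>-th powers up to powers
  of \<open>2\<close>, which gives \<open>c = u v\<close> with \<open>u < v\<close> and \<open>(v / u)\<^sup>N \<le> 4 (y + a) / (y - a)\<close>. The critical orbit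
  stays below the fixed point \<open>F(c)\<close>, so \<open>a / y \<le> \<surd>F(c)\<close>, while \<open>v / u \<ge> 1 + 1 / \<surd>c\<close>. Taking
  logarithms bounds \<open>N\<close>, that is, \<open>n < m\<close>.\<close>

section \<open>Divisibility and irreducibility under composition\<close>

text \<open>Composing the division of \<open>q\<close> by \<open>p\<close> with \<open>g\<close>
  leaves the remainder \<open>pcompose (q mod p) g\<close>. It is divisible by
  \<open>pcompose p g\<close>, but unless it vanishes its degree is too small for that.\<close>

lemma pcompose_dvd_pcomposeD:
  fixes p q g :: "'a::field poly"
  assumes "pcompose p g dvd pcompose q g" and "degree g > 0"
  shows "p dvd q"
proof -
  have "pcompose q g = pcompose p g * pcompose (q div p) g + pcompose (q mod p) g"
    by (metis mult_div_mod_eq pcompose_add pcompose_mult)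
  then have dvd: "pcompose p g dvd pcompose (q mod p) g"
    using assms(1) by (metis dvd_add_right_iff dvd_triv_left)
  have "q mod p = 0"
  proof (rule ccontr)
    assume nz: "q mod p \<noteq> 0"
    then have "pcompose (q mod p) g \<noteq> 0"
      using pcompose_eq_0 assms(2) by blast
    with dvd have "degree p * degree g \<le> degree (q mod p) * degree g"
      by (metis degree_pcompose dvd_imp_degree_le)
    then have "degree p \<le> degree (q mod p)"
      using assms(2) by simp
    moreover have "p \<noteq> 0"
      using dvd \<open>pcompose (q mod p) g \<noteq> 0\<close> by auto
    ultimately show False
      using degree_mod_less[of p q] nz by auto
  qed
  then show ?thesis by auto
qed

lemma irreducible_pcomposeD:
  fixes p g :: "'a::field poly"
  assumes "irreducible (pcompose p g)" and "degree g > 0"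
  shows "irreducible p"
proof (rule irreducibleI)
  show "p \<noteq> 0"
    using assms(1) by auto
  then show "\<not> p dvd 1"
    using assms(1) irreducible_not_unit[OF assms(1)]
    by (metis degree_pcompose is_unit_iff_degree mult_is_0 not_irreducible_zero)
next
  fix a b assume "p = a * b"
  then have eq: "pcompose p g = pcompose a g * pcompose b g"
    by (simp add: pcompose_mult)
  \<comment> \<open>Writing 1 as \<open>pcompose 1 g\<close> turns "is a unit" into a divisibility
    between composites, from which \<open>g\<close> can be cancelled.\<close>
  from irreducibleD[OF assms(1) this]
  have "pcompose a g dvd pcompose 1 g \<or> pcompose b g dvd pcompose 1 g"
    by (simp add: pcompose_1)
  then show "a dvd 1 \<or> b dvd 1"
    using pcompose_dvd_pcomposeD assms(2) by blast
qed

section \<open>Even polynomials\<close>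

text \<open>In characteristic 0 evenness kills the linear coefficient. Stripping the two lowest
  coefficients leaves an even polynomial of smaller degree.\<close>

lemma even_poly_eq_pcompose_square:
  fixes p :: "'a::field_char_0 poly"
  assumes "pcompose p [:0, -1:] = p"
  shows "\<exists>k. p = pcompose k [:0, 0, 1:]"
  using assms
proof (induction "degree p" arbitrary: p rule: less_induct)
  case less
  show ?case
  proof (cases "degree p = 0")
    case True
    then obtain a where "p = [:a:]"
      by (metis degree_eq_zeroE)
    then show ?thesis
      by (metis pcompose_const)
  next
    case False
    obtain a b q where p: "p = pCons a (pCons b q)"
      by (metis pCons_cases)
    have coeff: "(-1) ^ i * coeff p i = coeff p i" for i
      using less.prems by (metis coeff_pcompose_linear)
    from coeff[of 1] have b: "b = 0"
      by (simp add: p)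
    have "pcompose q [:0, -1:] = q"
    proof (rule poly_eqI)
      fix i show "coeff (pcompose q [:0, -1:]) i = coeff q i"
        using coeff[of "Suc (Suc i)"] by (simp add: p coeff_pcompose_linear)
    qed
    moreover have "degree q < degree p"
      using False by (auto simp: p b split: if_splits)
    ultimately obtain k where k: "q = pcompose k [:0, 0, 1:]"
      using less.hyps by blast
    have "p = pcompose (pCons a k) [:0, 0, 1:]"
      by (simp add: p b pcompose_pCons flip: k)
    then show ?thesis by blast
  qed
qed

lemma even_poly_eq_pcompose_quad:
  fixes p :: "'a::field_char_0 poly"
  assumes "pcompose p [:0, -1:] = p"
  shows "\<exists>k. p = pcompose k (quad_poly r)"
proof -
  obtain k where "p = pcompose k [:0, 0, 1:]"
    using even_poly_eq_pcompose_square[OF assms] by blast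
  \<comment> \<open>As x^2 = (x^2 + r) - r, polynomials in x^2 and polynomials in x^2 + r are the
    same.\<close>
  moreover have "[:0, 0, 1:] = pcompose [:-r, 1:] (quad_poly r)"
    by (simp add: quad_poly_def pcompose_pCons)
  ultimately show ?thesis
    by (metis pcompose_assoc)
qed

section \<open>A reducible g(x^2 + r) has square constant term\<close>

lemma degree_quad_poly [simp]: "degree (quad_poly r :: 'a::comm_semiring_1 poly) = 2"
  by (simp add: quad_poly_def)

lemma coeff_quad_poly_2 [simp]: "coeff (quad_poly r :: 'a::comm_semiring_1 poly) 2 = 1"
  by (simp add: quad_poly_def numeral_2_eq_2)

text \<open>As \<open>g\<close> is prime, it divides \<open>k\<close> or the cofactor
  \<open>l\<close>. Cancelling it leaves \<open>g\<close> as a product of two factors, one of which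
  is a non-unit by the degree bounds, so the other is constant.\<close>

lemma proper_divisor_irreducible_square:
  fixes g k :: "'a::field poly"
  assumes irr: "irreducible g" and dvd: "k dvd g\<^sup>2"
    and deg: "0 < degree k" "degree k < 2 * degree g"
  shows "\<exists>a. a \<noteq> 0 \<and> k = smult a g"
proof -
  have g0: "g \<noteq> 0" using irr by auto
  obtain l where l: "g\<^sup>2 = k * l" using dvd by blast
  have nz: "k \<noteq> 0" "l \<noteq> 0" using l g0 by auto
  have const: "\<exists>a. a \<noteq> 0 \<and> u = [:a:]" if "u dvd 1" for u :: "'a poly"
    using that by (auto simp: is_unit_poly_iff)
  have "g dvd k * l" by (metis dvd_triv_left l power2_eq_square)
  then have "g dvd k \<or> g dvd l"
    using field_poly_irreducible_imp_prime[OF irr] by (simp add: prime_elem_dvd_mult_iff)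
  then show ?thesis
  proof
    assume "g dvd k"
    then obtain m where m: "k = g * m" by blast
    have "g * g = g * (m * l)"
      using l by (simp add: m power2_eq_square mult.assoc)
    then have "g = m * l" using g0 by simp
    moreover have "\<not> l dvd 1"
    proof
      assume "l dvd 1"
      then have "degree l = 0" using nz is_unit_iff_degree by blast
      then have "degree (g\<^sup>2) = degree k" using nz by (simp add: l degree_mult_eq)
      then show False using deg g0 by (simp add: degree_power_eq)
    qed
    ultimately have "m dvd 1" using irreducibleD[OF irr] by blast
    then show ?thesis using const[of m] m by auto
  next
    assume "g dvd l"
    then obtain m where m: "l = g * m" by blast
    have "g * g = g * (k * m)"
      using l by (simp add: m power2_eq_square mult_ac)
    then have gkm: "g = k * m" using g0 by simp
    moreover have "\<not> k dvd 1" using deg is_unit_iff_degree[OF nz(1)] by simp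
    ultimately have "m dvd 1" using irreducibleD[OF irr] by blast
    then obtain a where "a \<noteq> 0" "m = [:a:]" using const by blast
    then have "k = smult (1 / a) g" using gkm by simp
    then show ?thesis using \<open>a \<noteq> 0\<close> by (metis divide_eq_0_iff zero_neq_one)
  qed
qed

text \<open>The norm \<open>h(x) h(-x)\<close> of a proper factor \<open>h\<close> of \<open>g(x\<^sup>2 + r)\<close> is even, so it is a polynomial
  in \<open>x\<^sup>2 + r\<close> that properly divides \<open>g(x\<^sup>2 + r)\<^sup>2\<close>; hence it is a multiple of \<open>g(x\<^sup>2 + r)\<close>.\<close>

lemma reducible_pcompose_quad_imp_square:
  fixes g :: "'a::field_char_0 poly"
  assumes irr: "irreducible g" and monic: "lead_coeff g = 1" and even: "even (degree g)"
    and red: "\<not> irreducible (pcompose g (quad_poly r))"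
  shows "\<exists>s. poly (pcompose g (quad_poly r)) 0 = s\<^sup>2"
proof -
  let ?f = "quad_poly r" and ?neg = "[:0, -1:] :: 'a poly"
  let ?G = "pcompose g ?f"
  have g0: "g \<noteq> 0" using irr by auto
  then have G0: "?G \<noteq> 0"
    using pcompose_eq_0[of g ?f] by auto
  have degG: "degree ?G = 2 * degree g" by (simp add: degree_pcompose)
  have "degree g > 0"
    using irr g0 irreducible_not_unit is_unit_iff_degree by blast
  then have "\<not> ?G dvd 1" using is_unit_iff_degree[OF G0] degG by simp
  then obtain h h' where hh: "?G = h * h'" "\<not> h dvd 1" "\<not> h' dvd 1"
    using red G0 irreducibleI by blast
  have nz: "h \<noteq> 0" "h' \<noteq> 0" using hh G0 by auto
  have degh: "0 < degree h" "degree h < 2 * degree g"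
    using hh nz is_unit_iff_degree[of h] is_unit_iff_degree[of h'] degG
    by (auto simp: degree_mult_eq)
  have negneg: "pcompose ?neg ?neg = [:0, 1:]"
    by (simp add: pcompose_pCons)
  have fneg: "pcompose ?f ?neg = ?f"
    by (simp add: quad_poly_def pcompose_pCons)
  define n where "n = h * pcompose h ?neg"
  have "pcompose n ?neg = n"
    by (simp add: n_def pcompose_mult negneg mult.commute flip: pcompose_assoc)
  then obtain k where k: "n = pcompose k ?f"
    using even_poly_eq_pcompose_quad by blast
  have hneg0: "pcompose h ?neg \<noteq> 0" using nz pcompose_eq_0[of h ?neg] by auto
  have "degree n = 2 * degree h"
    using nz hneg0 by (simp add: n_def degree_mult_eq degree_pcompose)
  then have degk: "degree k = degree h"
    by (simp add: k degree_pcompose)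
  \<comment> \<open>\<open>?G\<close> is even, so h(-x) divides it along with h(x). Hence
    \<open>n\<close> divides the square of \<open>?G\<close>, and \<open>quad_poly r\<close> can be
    cancelled.\<close>
  have "pcompose ?G ?neg = ?G"
    by (simp add: fneg flip: pcompose_assoc)
  then have "pcompose h ?neg dvd ?G"
    using hh(1) by (metis dvd_triv_left pcompose_mult)
  then have "n dvd ?G * ?G"
    unfolding n_def using hh(1) by (intro mult_dvd_mono) auto
  then have "pcompose k ?f dvd pcompose (g\<^sup>2) ?f"
    by (simp add: k power2_eq_square pcompose_mult)
  then have "k dvd g\<^sup>2"
    by (rule pcompose_dvd_pcomposeD) simp
  then obtain a where a: "a \<noteq> 0" "k = smult a g"
    using proper_divisor_irreducible_square[OF irr] degk degh by metis
  have degg: "degree h = degree g" using degk a by simp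
  have na: "n = smult a ?G" by (simp add: k a pcompose_smult)
  have "lead_coeff ?G = 1" using monic by (subst lead_coeff_comp) auto
  then have "lead_coeff n = a" using na by simp
  \<comment> \<open>Since \<open>h\<close> has the even degree of \<open>g\<close>, the sign change
    leaves its leading coefficient alone. So \<open>a\<close> is a square and can be divided out of
    a G(0) = h(0)^2.\<close>
  moreover have "lead_coeff (pcompose h ?neg) = lead_coeff h"
    using even degg by (subst lead_coeff_comp) auto
  ultimately have lead: "a = (lead_coeff h)\<^sup>2"
    by (simp add: n_def lead_coeff_mult power2_eq_square)
  have "a * poly ?G 0 = (poly h 0)\<^sup>2"
    using arg_cong[OF na, of "\<lambda>p. poly p 0"]
    by (simp add: n_def poly_pcompose power2_eq_square)
  then have "poly ?G 0 = (poly h 0 / lead_coeff h)\<^sup>2"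
    using lead nz by (simp add: power_divide field_simps)
  then show ?thesis by blast
qed

section \<open>Iterates of the quadratic polynomial\<close>

lemma poly_iterate_Suc: "poly_iterate p (Suc n) = pcompose p (poly_iterate p n)"
  by (simp add: poly_iterate_def)

text \<open>With the new factor innermost, both \<open>irreducible_pcomposeD\<close> and the square
  criterion apply to iterates; the outer form serves for evaluation at 0.\<close>

lemma poly_iterate_Suc_right:
  "poly_iterate p (Suc n) = pcompose (poly_iterate p n) p"
  by (induction n) (simp_all add: poly_iterate_def pcompose_assoc pcompose_pCons)

lemma degree_poly_iterate_quad:
  "degree (poly_iterate (quad_poly (r :: 'a::field)) n) = 2 ^ n"
  by (induction n) (simp_all add: poly_iterate_def degree_pcompose)

lemma lead_coeff_poly_iterate_quad:
  "lead_coeff (poly_iterate (quad_poly (r :: 'a::field)) n) = 1"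
proof (induction n)
  case (Suc n)
  then show ?case
    unfolding poly_iterate_Suc_right by (subst lead_coeff_comp) auto
qed (simp add: poly_iterate_def)

lemma irreducible_poly_iterate_le:
  fixes p :: "'a::field poly"
  assumes "irreducible (poly_iterate p n)" and "m \<le> n" and "degree p > 0"
  shows "irreducible (poly_iterate p m)"
  using assms(2,1)
proof (induction rule: dec_induct)
  case (step n)
  then show ?case
    using irreducible_pcomposeD[OF _ assms(3)] by (simp add: poly_iterate_Suc_right)
qed

section \<open>Numerators of the critical orbit\<close>

text \<open>For q = m/d in lowest terms, m^2 = a d^2 makes d divide m, so d = 1.\<close>

lemma rat_square_of_nat:
  fixes q :: rat
  assumes "of_nat a = q\<^sup>2"
  shows "\<exists>y. a = y\<^sup>2"
proof -
  obtain m d where md: "quotient_of q = (m, d)" by fastforce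
  have d: "d > 0" and cop: "coprime m d" and q: "q = of_int m / of_int d"
    using md quotient_of_denom_pos quotient_of_coprime quotient_of_div by blast+
  have "of_int (m\<^sup>2) = (of_int (int a * d\<^sup>2) :: rat)"
    using assms d by (simp add: q field_simps power2_eq_square)
  then have eq: "m\<^sup>2 = int a * d\<^sup>2" by (simp only: of_int_eq_iff)
  then have "d dvd m" by (metis dvd_triv_right pow_divides_pow_iff zero_less_numeral)
  then have "d = 1" using cop d by (metis abs_of_pos coprime_absorb_right zdvd1_eq)
  then have "a = (nat \<bar>m\<bar>)\<^sup>2"
    using eq by (metis mult.right_neutral nat_int nat_power_eq one_power2 power2_abs abs_ge_zero)
  then show ?thesis by blast
qed

text \<open>Numerator of the iterate number n + 1 (not n) at 0 over the denominator c^(2^n). The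
  added power is the numerator of 1/c over c^(2^(n+1)).\<close>

fun orbit_numer :: "nat \<Rightarrow> nat \<Rightarrow> nat" where
  "orbit_numer c 0 = 1"
| "orbit_numer c (Suc n) = (orbit_numer c n)\<^sup>2 + c ^ (2 ^ Suc n - 1)"

lemma poly_iterate_quad_at_0:
  fixes c :: nat
  assumes "c > 0"
  shows "poly (poly_iterate (quad_poly (1 / of_nat c :: rat)) (Suc n)) 0
    = of_nat (orbit_numer c n) / of_nat c ^ (2 ^ n)"
proof (induction n)
  case 0
  show ?case by (simp add: poly_iterate_def quad_poly_def pcompose_pCons)
next
  case (Suc n)
  let ?N = "2 ^ Suc n :: nat"
  have pow: "(of_nat c :: rat) ^ ?N = of_nat c * of_nat c ^ (?N - 1)"
    by (metis Suc_pred' pos2 power_Suc zero_less_power)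
  have inv: "1 / of_nat c = (of_nat (c ^ (?N - 1)) :: rat) / of_nat c ^ ?N"
    using assms by (simp only: pow) simp
  have "poly (poly_iterate (quad_poly (1 / of_nat c :: rat)) (Suc (Suc n))) 0
      = (of_nat (orbit_numer c n) / of_nat c ^ (2 ^ n))\<^sup>2 + 1 / of_nat c"
    using Suc by (subst poly_iterate_Suc)
      (simp add: poly_pcompose quad_poly_def power2_eq_square)
  also have "(of_nat (orbit_numer c n) / of_nat c ^ (2 ^ n) :: rat)\<^sup>2
      = of_nat ((orbit_numer c n)\<^sup>2) / of_nat c ^ ?N"
    by (simp add: power_divide mult.commute flip: power_mult)
  also have "of_nat ((orbit_numer c n)\<^sup>2) / of_nat c ^ ?N + 1 / of_nat c
      = (of_nat (orbit_numer c (Suc n)) :: rat) / of_nat c ^ ?N"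
    unfolding inv by (simp add: add_divide_distrib)
  finally show ?case .
qed

text \<open>The added power is divisible by \<open>c\<close>, so modulo \<open>c\<close> each
  numerator is the square of the previous one.\<close>

lemma coprime_orbit_numer: "coprime (orbit_numer c n) c"
proof (cases n)
  case (Suc k)
  show ?thesis unfolding Suc
  proof (induction k)
    case 0
    then show ?case by simp
  next
    case (Suc k)
    have "c dvd c ^ (2 ^ Suc (Suc k) - 1)"
      by (rule dvd_power) (use one_less_power[of "2::nat" "Suc (Suc k)"] in simp)
    then obtain z where "c ^ (2 ^ Suc (Suc k) - 1) = c * z" by blast
    moreover have "coprime ((orbit_numer c (Suc k))\<^sup>2) c" using Suc by simp
    ultimately show ?case
      by (simp only: orbit_numer.simps(2)[of c "Suc k"]) (metis coprime_iff_gcd_eq_1 gcd_add_mult gcd.commute add.commute mult.commute)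
  qed
qed simp

text \<open>\<open>F c\<close> is the smaller root of x = x^2 + 1/c (the double root if c = 4), a
  fixed point of f.\<close>

lemma F_props:
  assumes "c \<ge> 4"
  shows "0 < F c" "F c \<le> 1 / 2" "F c = (F c)\<^sup>2 + 1 / c"
proof -
  have c: "0 < 4 / c" "4 / c \<le> 1" using assms by auto
  then show "0 < F c" "F c \<le> 1 / 2"
    by (auto simp: F_def)
  have "(sqrt (1 - 4 / c))\<^sup>2 = 1 - 4 / c" using c by simp
  then show "F c = (F c)\<^sup>2 + 1 / c"
    by (simp add: F_def power2_eq_square field_simps)
qed

text \<open>The map f is increasing on nonnegative reals, so the orbit of 0 cannot pass the fixed
  point \<open>F c\<close>.\<close>

lemma orbit_numer_le_F:
  assumes "c \<ge> 4"
  shows "real (orbit_numer c n) \<le> F (real c) * real c ^ (2 ^ n)"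
proof (induction n)
  case 0
  have "1 / real c \<le> F (real c)"
    using F_props(3)[of "real c"] assms by (metis le_add_same_cancel2 numeral_le_real_of_nat_iff zero_le_power2)
  then show ?case using assms by (simp add: field_simps)
next
  case (Suc n)
  let ?N = "2 ^ Suc n :: nat"
  have pow: "real c ^ ?N = real c * real c ^ (?N - 1)"
    by (metis Suc_pred' pos2 power_Suc zero_less_power)
  have "(real (orbit_numer c n))\<^sup>2 \<le> (F (real c) * real c ^ (2 ^ n))\<^sup>2"
    using Suc by (intro power_mono) auto
  also have "\<dots> = (F (real c))\<^sup>2 * real c ^ ?N"
    by (simp add: power_mult_distrib mult.commute flip: power_mult)
  finally have "real (orbit_numer c (Suc n)) \<le> (F (real c))\<^sup>2 * real c ^ ?N + real c ^ (?N - 1)"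
    by simp
  also have "real c ^ (?N - 1) = 1 / real c * real c ^ ?N"
    using assms by (simp only: pow) simp
  also have "(F (real c))\<^sup>2 * real c ^ ?N + 1 / real c * real c ^ ?N = F (real c) * real c ^ ?N"
    using F_props(3)[of "real c"] assms by (metis distrib_right numeral_le_real_of_nat_iff)
  finally show ?case .
qed

section \<open>Factoring a power as a difference of two squares\<close>

lemma coprime_mult_eq_powerE:
  fixes a b c :: nat
  assumes "a * b = c ^ n" and "coprime a b" and "n > 0"
  obtains u v where "a = u ^ n" "b = v ^ n" "u * v = c"
proof -
  have "is_nth_power n (a * b)"
    by (metis assms(1) is_nth_power_nth_power)
  then obtain u v where uv: "a = u ^ n" "b = v ^ n"
    using is_nth_power_mult_coprime_nat_iff[OF assms(2)] by (metis is_nth_powerE)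
  then have "(u * v) ^ n = c ^ n"
    using assms(1) by (simp add: power_mult_distrib)
  then have "u * v = c"
    using assms(3) power_eq_iff_eq_base by blast
  with uv that show ?thesis by blast
qed

text \<open>When \<open>c\<close> is even, the two factors are exactly \<open>2 u\<^sup>n\<close> and \<open>v\<^sup>n / 2\<close> in some order;
  this is where the constant \<open>4\<close> comes from.\<close>

lemma coprime_square_plus_power:
  fixes a y c n :: nat
  assumes eq: "y\<^sup>2 = a\<^sup>2 + c ^ n" and cop: "coprime a c" and "c > 1" and n: "n > 0"
  obtains u v where "u * v = c" "u < v" "real v ^ n * real (y - a) \<le> 4 * real (y + a) * real u ^ n"
proof -
  note witness = that
  have cn: "c ^ n > 0" using \<open>c > 1\<close> by simp
  then have "a\<^sup>2 < y\<^sup>2" using eq by simp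
  then have "a < y" by (simp add: power_less_imp_less_base)
  define d where "d = y - a"
  have y: "y = a + d" and d: "d > 0" using \<open>a < y\<close> by (auto simp: d_def)
  have prod: "d * (d + 2 * a) = c ^ n"
    using eq by (simp add: y power2_eq_square algebra_simps)
  have goal: thesis if uv: "u * v = c" "u < v" "real v ^ n * real d \<le> 4 * real (d + 2 * a) * real u ^ n" for u v
  proof (rule witness[OF uv(1,2)])
    have "y - a = d" "y + a = d + 2 * a" by (simp_all add: y)
    then show "real v ^ n * real (y - a) \<le> 4 * real (y + a) * real u ^ n"
      using uv(3) by (simp add: algebra_simps)
  qed
  have copn: "coprime a (c ^ n)" using cop by simp
  have cop_d: "coprime a d"
    using copn prod by (metis coprime_mult_right_iff)
  have neq: "u \<noteq> v" if "u * v = c" "coprime u v" for u v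
    using that \<open>c > 1\<close> by (metis coprime_self is_unit_mult_iff nat_dvd_1_iff_1 less_irrefl)
  show thesis
  proof (cases "even c")
    \<comment> \<open>For odd \<open>c\<close> both factors are odd and coprime, hence exact n-th
      powers; the constant 4 is slack here.\<close>
    case False
    then have "odd d" using prod n by (metis even_mult_iff even_power)
    then have "coprime d (2 * a)"
      using cop_d by (simp add: coprime_commute)
    then have "coprime d (d + 2 * a)"
      by (simp add: coprime_iff_gcd_eq_1)
    with prod n obtain u v where uv: "d = u ^ n" "d + 2 * a = v ^ n" "u * v = c"
      by (metis coprime_mult_eq_powerE)
    have "a > 0" using cop \<open>c > 1\<close> by (cases a) auto
    then have "u ^ n < v ^ n" using uv by linarith
    then have "u < v" by (simp add: power_less_imp_less_base)
    moreover have pow: "real v ^ n = real (d + 2 * a)" "real u ^ n = real d"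
      using uv(1,2) by (metis of_nat_power)+
    have "real v ^ n * real d \<le> 4 * real (d + 2 * a) * real u ^ n"
      unfolding pow by (simp add: algebra_simps)
    ultimately show thesis using goal uv(3) by blast
  next
    case True
    then have "odd a" using cop coprime_common_divisor[of a c 2] by auto
    have "even (c ^ n)" using True n by simp
    then have "even d" using prod by (metis even_add even_mult_iff even_numeral)
    then obtain e where e: "d = 2 * e" by blast
    define e' where "e' = e + a"
    have e': "d + 2 * a = 2 * e'" by (simp add: e e'_def)
    have prod': "4 * (e * e') = c ^ n" using prod by (simp add: e e'_def algebra_simps)
    have "coprime e a" using cop_d e by (simp add: coprime_commute)
    then have cop': "coprime e e'" by (simp add: e'_def coprime_iff_gcd_eq_1)
    have "e < e'" "e > 0" using \<open>odd a\<close> d e by (auto simp: e'_def intro: Nat.gr0I)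
    have re: "real (d + 2 * a) = 2 * real e'" "real d = 2 * real e"
      by (simp_all add: e e'_def)
    \<comment> \<open>This reduces coprimality with \<open>4 * m\<close> to oddness and coprimality
      with \<open>m\<close>.\<close>
    have four: "4 * m = 2 * (2 * m)" for m :: nat by simp
    \<comment> \<open>The halves differ by the odd number \<open>a\<close>, so one of them is odd;
      attaching 4 to the other keeps the factors coprime.\<close>
    have "odd e \<or> odd e'" using \<open>odd a\<close> by (auto simp: e'_def)
    then show thesis
    proof
      assume "odd e"
      then have "coprime e (4 * e')"
        using cop' unfolding four
        by (simp only: coprime_mult_right_iff coprime_right_2_iff_odd simp_thms)
      moreover have "e * (4 * e') = c ^ n" using prod' by simp
      ultimately obtain u v where uv: "e = u ^ n" "4 * e' = v ^ n" "u * v = c"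
        using n by (metis coprime_mult_eq_powerE)
      have "u ^ n < v ^ n" using \<open>e < e'\<close> uv by linarith
      then have "u < v" by (simp add: power_less_imp_less_base)
      moreover have pow: "real v ^ n = 4 * real e'" "real u ^ n = real e"
        using uv by (metis of_nat_mult of_nat_numeral of_nat_power)+
      \<comment> \<open>Both sides equal 8 e e', so the constant 4 is attained.\<close>
      have "real v ^ n * real d \<le> 4 * real (d + 2 * a) * real u ^ n"
        unfolding pow re by simp
      ultimately show thesis using goal uv(3) by blast
    next
      assume "odd e'"
      then have "coprime e' (4 * e)"
        using cop'[unfolded coprime_commute[of e]] unfolding four
        by (simp only: coprime_mult_right_iff coprime_right_2_iff_odd simp_thms)
      moreover have "e' * (4 * e) = c ^ n" using prod' by (simp add: mult.commute)
      ultimately obtain u v where uv: "e' = u ^ n" "4 * e = v ^ n" "u * v = c"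
        using n by (metis coprime_mult_eq_powerE)
      have "coprime u v"
        using \<open>coprime e' (4 * e)\<close> uv n by simp
      then have "u \<noteq> v" using neq uv(3) by blast
      have u: "real u ^ n = real e'" and v: "real v ^ n = 4 * real e"
        using uv by (metis of_nat_mult of_nat_numeral of_nat_power)+
      have ee: "real e * real e \<le> real e' * real e'"
        using \<open>e < e'\<close> by (intro mult_mono) auto
      \<comment> \<open>From \<open>e < e'\<close> alone it is open whether \<open>e'\<close> or
        \<open>4 * e\<close> is larger, so either root may be the smaller one.\<close>
      show thesis
      proof (cases "u < v")
        case True
        have "real v ^ n * real d \<le> 4 * real (d + 2 * a) * real u ^ n"
          unfolding u v re using ee by simp
        then show thesis using goal uv(3) True by blast
      next
        case False
        have "real u ^ n * real d \<le> 4 * real (d + 2 * a) * real v ^ n"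
          unfolding u v re using \<open>e > 0\<close> by simp
        then show thesis using goal[of v u] uv(3) False \<open>u \<noteq> v\<close> by (simp add: mult.commute)
      qed
    qed
  qed
qed

section \<open>Bounding the exponent\<close>

text \<open>With s = sqrt (F c), this is the logarithm of the chain (1 + 1/sqrt c)^N \<le> (v/u)^N
  \<le> 4 (y + a)/(y - a) \<le> 4 (1 + s)/(1 - s).\<close>

lemma orbit_numer_square_bound:
  assumes c: "c \<ge> 4" and sq: "orbit_numer c (Suc n) = y\<^sup>2"
  shows "(2 ^ Suc n - 1) * ln (1 + 1 / sqrt c) \<le> ln 4 + eps c / sqrt c"
proof -
  define N :: nat where "N = 2 ^ Suc n - 1"
  define a where "a = orbit_numer c n"
  let ?F = "F (real c)"
  let ?s = "sqrt ?F"
  have N: "N > 0" "2 ^ Suc n = Suc N"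
    using one_less_power[of "2::nat" "Suc n"] by (simp_all add: N_def)
  have F: "0 < ?F" "?F \<le> 1 / 2" "?F = ?F\<^sup>2 + 1 / real c"
    using F_props[of "real c"] c by simp_all
  have s: "0 < ?s" "?s < 1" "?s\<^sup>2 = ?F" using F by auto
  have eq: "y\<^sup>2 = a\<^sup>2 + c ^ N"
    using sq by (simp add: N_def a_def)
  obtain u v where uv: "u * v = c" "u < v"
    and bound: "real v ^ N * real (y - a) \<le> 4 * real (y + a) * real u ^ N"
    using coprime_square_plus_power[OF eq] coprime_orbit_numer[of c n] c N(1)
    unfolding a_def by (metis One_nat_def less_le_trans numeral_le_one_iff not_le semiring_norm(69))
  have "a\<^sup>2 < y\<^sup>2" using eq c by simp
  then have "a < y" by (simp add: power_less_imp_less_base)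
  \<comment> \<open>The fixed-point equation gives F (1 - F) c = 1. So the orbit bound becomes a^2
    (1 - F) \<le> F c^N, that is, a^2 \<le> F (a^2 + c^N) = F y^2.\<close>
  have "(real a)\<^sup>2 \<le> (?F * real c ^ (2 ^ n))\<^sup>2"
    unfolding a_def by (intro power_mono orbit_numer_le_F c) auto
  also have "\<dots> = ?F\<^sup>2 * real c * real c ^ N"
    by (simp add: power_mult_distrib mult.assoc mult.commute flip: power_mult power_Suc N(2))
  finally have "(real a)\<^sup>2 * (1 - ?F) \<le> ?F\<^sup>2 * real c * real c ^ N * (1 - ?F)"
    using F(2) by (intro mult_right_mono) auto
  also have "\<dots> = ?F * (?F * (1 - ?F) * real c) * real c ^ N"
    by (simp add: power2_eq_square)
  also have "?F * (1 - ?F) * real c = 1"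
    using F(3) c by (simp add: field_simps power2_eq_square)
  finally have "(real a)\<^sup>2 \<le> ?F * ((real a)\<^sup>2 + real c ^ N)"
    by (simp add: algebra_simps)
  also have "(real a)\<^sup>2 + real c ^ N = (real y)\<^sup>2"
    using eq by (metis of_nat_add of_nat_power)
  finally have "(real a)\<^sup>2 \<le> (?s * real y)\<^sup>2"
    by (simp add: power_mult_distrib s(3))
  then have ay: "real a \<le> ?s * real y"
    using s(1) by (simp add: power2_le_iff_abs_le)
  have u: "real u > 0" using uv c by (cases u) auto
  have y: "real (y - a) = real y - real a" "real y - real a > 0" using \<open>a < y\<close> by simp_all
  have "(1 + ?s) / (1 - ?s) \<ge> (real y + real a) / (real y - real a)"
  proof -
    have "(real y + real a) * (1 - ?s) \<le> (1 + ?s) * (real y - real a)"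
      using ay by (simp add: algebra_simps)
    then show ?thesis using y s by (simp add: divide_simps)
  qed
  moreover have "(real v / real u) ^ N \<le> 4 * ((real y + real a) / (real y - real a))"
    using bound y u by (simp add: power_divide divide_simps mult_ac)
  ultimately have vu: "(real v / real u) ^ N \<le> 4 * ((1 + ?s) / (1 - ?s))"
    by linarith
  \<comment> \<open>From u < v and u v = c follows u < sqrt c, and v \<ge> u + 1 then gives v/u
    \<ge> 1 + 1/u \<ge> 1 + 1/sqrt c.\<close>
  have "u * u < c" using uv u by (simp flip: uv(1))
  then have "real u < sqrt (real c)"
    by (metis of_nat_less_iff of_nat_mult power2_eq_square real_less_rsqrt)
  then have "1 / sqrt c \<le> 1 / real u" using u c by (intro frac_le) auto
  moreover have "1 + 1 / real u \<le> real v / real u"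
  proof -
    have "real u + 1 \<le> real v" using uv(2) by simp
    then have "(real u + 1) / real u \<le> real v / real u"
      using u by (intro divide_right_mono) auto
    then show ?thesis using u by (simp add: add_divide_distrib)
  qed
  ultimately have "1 + 1 / sqrt c \<le> real v / real u" by linarith
  then have "(1 + 1 / sqrt c) ^ N \<le> (real v / real u) ^ N"
    by (intro power_mono) auto
  with vu have "(1 + 1 / sqrt c) ^ N \<le> 4 * ((1 + ?s) / (1 - ?s))" by linarith
  moreover have pos: "0 < 1 + 1 / sqrt c" using c by (simp add: add_pos_nonneg)
  moreover have quot: "0 < (1 + ?s) / (1 - ?s)" using s(1,2) by (intro divide_pos_pos) linarith+
  ultimately have "ln ((1 + 1 / sqrt c) ^ N) \<le> ln (4 * ((1 + ?s) / (1 - ?s)))"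
    by (intro ln_mono) auto
  also have "\<dots> = ln 4 + ln ((1 + ?s) / (1 - ?s))"
    using quot by (intro ln_mult_pos) auto
  finally have "real N * ln (1 + 1 / sqrt c) \<le> ln 4 + ln ((1 + ?s) / (1 - ?s))"
    using pos by (simp only: ln_realpow)
  moreover have "real N = 2 ^ Suc n - 1" 
    using arg_cong[OF N(2), of real] by simp
  moreover have "eps c / sqrt c = ln ((1 + ?s) / (1 - ?s))"
    using c by (simp add: eps_def)
  ultimately show ?thesis by simp
qed

section \<open>The test index and the passage to all iterates\<close>

text \<open>One plus the floor of log 2 B strictly exceeds log 2 B, so 2^n > B from that index on.
  The resulting inequality contradicts \<open>orbit_numer_square_bound\<close>.\<close>

lemma test_index_bound:
  assumes "c \<ge> 4"
  shows "test_index c \<ge> 1"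
    and "test_index c \<le> n \<Longrightarrow> ln 4 + eps c / sqrt c < (2 ^ n - 1) * ln (1 + 1 / sqrt c)"
proof -
  let ?l = "ln (1 + 1 / sqrt c)" and ?b = "ln 4 + eps c / sqrt c"
  have l: "?l > 0" using assms by (intro ln_gt_zero) simp
  have "0 < sqrt (F c)" "sqrt (F c) < 1"
    using F_props[OF assms] by simp_all
  then have "ln ((1 + sqrt (F c)) / (1 - sqrt (F c))) > 0"
    by (intro ln_gt_zero) (simp add: field_simps)
  then have "eps c \<ge> 0" using assms by (simp add: eps_def)
  then have b: "?b > 0" using assms by (intro add_pos_nonneg) auto
  let ?B = "1 + ?b / ?l"
  have B: "?B > 1" using b l by simp
  then have fl: "\<lfloor>log 2 ?B\<rfloor> \<ge> 0" by simp
  then show "test_index c \<ge> 1" unfolding test_index_def by linarith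
  assume "test_index c \<le> n"
  then have "1 + \<lfloor>log 2 ?B\<rfloor> \<le> int n" using fl unfolding test_index_def by linarith
  then have "log 2 ?B < real n" by linarith
  then have "?B < 2 ^ n"
    using B by (subst (asm) log_less_iff) (auto simp: powr_realpow)
  then have "?b / ?l < 2 ^ n - 1" by linarith
  then show "?b < (2 ^ n - 1) * ?l" using l by (simp add: divide_less_eq)
qed

theorem theorem1p3:
  fixes c :: int and r :: rat and f :: "rat poly"
  assumes "c \<ge> 4"
    and "r = 1 / of_int c"
    and "f = quad_poly r"
    and "irreducible (poly_iterate f (test_index (real_of_int c)))"
  shows "\<forall>n\<ge>1. irreducible (poly_iterate f n)"
proof -
  let ?m = "test_index (real_of_int c)"
  define d where "d = nat c"
  have cd: "c = int d" and d: "d \<ge> 4" using assms(1) by (auto simp: d_def)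
  have f: "f = quad_poly (1 / of_nat d)" using assms(2,3) cd by simp
  have m: "?m \<ge> 1" using test_index_bound(1) assms(1) by simp
  have up: "irreducible (poly_iterate f n)" if "?m \<le> n" for n
    using that
  proof (induction rule: dec_induct)
    case base
    show ?case by (rule assms(4))
  next
    case (step n)
    show ?case
    proof (rule ccontr)
      assume red: "\<not> irreducible (poly_iterate f (Suc n))"
      \<comment> \<open>Having n \<ge> 1 makes the degree 2^n even and the denominator d^(2^n) the
        square of d^(2^k).\<close>
      obtain k where k: "n = Suc k" using step.hyps m by (cases n) auto
      have "even (degree (poly_iterate f n))"
        by (simp add: assms(3) degree_poly_iterate_quad k)
      then obtain s where "poly (poly_iterate f (Suc n)) 0 = s\<^sup>2"
        using reducible_pcompose_quad_imp_square[OF step.IH] red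
          lead_coeff_poly_iterate_quad
        unfolding assms(3) poly_iterate_Suc_right by blast
      then have "of_nat (orbit_numer d n) / of_nat d ^ (2 ^ n) = s\<^sup>2"
        using poly_iterate_quad_at_0[of d n] d f by simp
      then have "of_nat (orbit_numer d n) = (s * of_nat d ^ (2 ^ k))\<^sup>2"
        using d by (simp add: k field_simps power_mult_distrib flip: power_mult)
      then obtain y where "orbit_numer d (Suc k) = y\<^sup>2"
        using rat_square_of_nat k by blast
      from orbit_numer_square_bound[OF d this] test_index_bound(2)[of c n] step.hyps(1) assms(1)
      show False by (simp add: cd k)
    qed
  qed
  show ?thesis
  proof (intro allI impI)
    fix n :: nat assume "n \<ge> 1"
    show "irreducible (poly_iterate f n)"
    proof (cases "?m \<le> n")
      \<comment> \<open>Below the test index irreducibility descends, because the iterate tested is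
        a composite with inner iterates of \<open>f\<close>.\<close>
      case False
      then show ?thesis
        using irreducible_poly_iterate_le[OF assms(4), of n] assms(3) by simp
    qed (rule up)
  qed
qed

end
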